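(* Let $f:\mathbb{R}^n\to\mathbb{R}\cup\{+\infty\}$ be proper, lower semicontinuous and convex, $A\in\mathbb{R}^{m\times n}$, $b\in\mathbb{R}^m$, and let $X$ be the set of minimizers over $x\in\mathbb{R}^n$ of $f(x)+\frac12\|Ax-b\|^2$. Let $x^\star\in X$, $r=b-Ax^\star$, $x_{\mathsf r}^\star=\mathcal P_{\operatorname{ran}A^\top}x^\star$ and $x_{\mathsf k}^\star=\mathcal P_{\ker A}x^\star$. Then $x^\star$ is the unique solution (i.e. $X=\{x^\star\}$) (i) if and only if $(\partial f^*(A^\top r)-x_{\mathsf r}^\star)\cap\ker A$ is a singleton; (ii) if and only if $(\partial f^*(A^\top r)-x^\star)\cap\ker A=\{0\}$; (iii) if $\mathcal P_{\ker A}(\partial f^*(A^\top r)-x^\star)=\{0\}$, or equivalently, $\mathcal P_{\ker A}(\partial f^*(A^\top r))=\{x_{\mathsf k}^\star\}$. Furthermore, this condition is equivalent to $(\partial f^*(A^\top r)-x^\star)\perp\ker A$, and thus $\partial f^*(A^\top r)\subseteq x_{\mathsf k}^\star+\operatorname{ran}A^\top$.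
   Context: $f^*$ is the convex conjugate, $\partial$ the convex subdifferential; $\mathcal P_S$ is the orthogonal projection onto a subspace $S$, applied elementwise to sets. For a set $C$, $C\perp\ker A$ means every element of $C$ is orthogonal to $\ker A$. *)

theory Defs
  imports "HOL-Analysis.Analysis"
begin

text \<open>Functions with values in \<open>\<real> \<union> {+\<infinity>}\<close> are rendered as \<^typ>\<open>ereal\<close>-valued functions
  that never take the value \<open>-\<infinity>\<close>, which is part of \<open>proper_fun\<close>.\<close>

definition proper_fun :: "('a \<Rightarrow> ereal) \<Rightarrow> bool" where
  "proper_fun f \<longleftrightarrow> (\<forall>x. f x \<noteq> -\<infinity>) \<and> (\<exists>x. f x \<noteq> \<infinity>)"

definition lsc_fun :: "('a::topological_space \<Rightarrow> ereal) \<Rightarrow> bool" where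
  "lsc_fun f \<longleftrightarrow> (\<forall>x. f x \<le> Liminf (at x) f)"

text \<open>Only meaningful if \<open>f\<close> never takes the value \<open>-\<infinity>\<close>, so that no \<open>\<infinity> - \<infinity>\<close> arises on the
  right-hand side. At the endpoints \<open>t = 0\<close> and \<open>t = 1\<close> the convention \<open>0 * \<infinity> = 0\<close> makes the
  inequality trivial.\<close>

definition convex_fun :: "('a::real_vector \<Rightarrow> ereal) \<Rightarrow> bool" where
  "convex_fun f \<longleftrightarrow>
     (\<forall>x y t. 0 \<le> t \<and> t \<le> 1 \<longrightarrow>
        f ((1 - t) *\<^sub>R x + t *\<^sub>R y) \<le> ereal (1 - t) * f x + ereal t * f y)"

definition conjugate :: "('a::real_inner \<Rightarrow> ereal) \<Rightarrow> 'a \<Rightarrow> ereal" where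
  "conjugate f u = (SUP x. ereal (u \<bullet> x) - f x)"

text \<open>For a proper \<open>g\<close> this set is empty wherever \<open>g u = \<infinity>\<close>.\<close>

definition subdifferential :: "('a::real_inner \<Rightarrow> ereal) \<Rightarrow> 'a \<Rightarrow> 'a set" where
  "subdifferential g u = {v. \<forall>w. g u + ereal (v \<bullet> (w - u)) \<le> g w}"

definition minimizers :: "('a \<Rightarrow> 'b::linorder) \<Rightarrow> 'a set" where
  "minimizers F = {x. \<forall>y. F x \<le> F y}"

definition mat_ker :: "real^'n^'m \<Rightarrow> (real^'n) set" where
  "mat_ker A = {x. A *v x = 0}"

definition mat_ran :: "real^'n^'m \<Rightarrow> (real^'m) set" where
  "mat_ran A = range (\<lambda>x. A *v x)"

definition orth_proj :: "'a::real_inner set \<Rightarrow> 'a \<Rightarrow> 'a" where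
  "orth_proj S x = (THE y. y \<in> S \<and> (\<forall>z\<in>S. orthogonal (x - y) z))"

lemma orth_proj_eqI:
  assumes "subspace S" "y \<in> S" "\<And>z. z \<in> S \<Longrightarrow> orthogonal (x - y) z"
  shows "orth_proj S x = y"
  unfolding orth_proj_def
proof (rule the_equality)
  fix w assume w: "w \<in> S \<and> (\<forall>z\<in>S. orthogonal (x - w) z)"
  then have "y - w \<in> S"
    using assms by (simp add: subspace_diff)
  then have "(x - w) \<bullet> (y - w) = 0" "(x - y) \<bullet> (y - w) = 0"
    using w assms(3) by (auto simp: orthogonal_def)
  then have "(y - w) \<bullet> (y - w) = 0"
    by (simp add: inner_diff_left)
  then show "w = y" by simp
qed (use assms in auto)

lemma orth_proj_props:
  fixes S :: "'a::euclidean_space set"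
  assumes "subspace S"
  shows "orth_proj S x \<in> S" and "z \<in> S \<Longrightarrow> orthogonal (x - orth_proj S x) z"
proof -
  obtain y w where "y \<in> span S" "\<And>v. v \<in> span S \<Longrightarrow> orthogonal w v" "x = y + w"
    using orthogonal_subspace_decomp_exists[of S x] by metis
  then have *: "y \<in> S" "\<And>v. v \<in> S \<Longrightarrow> orthogonal (x - y) v"
    using assms by (auto simp: span_eq_iff[THEN iffD2])
  with orth_proj_eqI[OF assms] have "orth_proj S x = y" by blast
  with * show "orth_proj S x \<in> S" "z \<in> S \<Longrightarrow> orthogonal (x - orth_proj S x) z" by auto
qed

lemma subspace_mat_ker: "subspace (mat_ker A)"
  by (auto simp: subspace_def mat_ker_def matrix_vector_right_distrib
      matrix_vector_mult_scaleR)

lemma subspace_mat_ran: "subspace (mat_ran A)"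
  unfolding mat_ran_def
  by (rule linear_subspace_image[OF matrix_vector_mul_linear subspace_UNIV])

definition perp :: "'a::real_inner set \<Rightarrow> 'a set \<Rightarrow> bool" where
  "perp C S \<longleftrightarrow> (\<forall>c\<in>C. \<forall>z\<in>S. orthogonal c z)"

definition translate_minus :: "'a::ab_group_add set \<Rightarrow> 'a \<Rightarrow> 'a set" where
  "translate_minus C a = (\<lambda>c. c - a) ` C"

end

theory Submission
  imports Defs
begin

text \<open>Put \<open>u = A\<^sup>T r\<close> and \<open>C = \<partial>f\<^sup>* u\<close>. Everything follows from the description
  \<open>X = {x \<in> C. x - x\<^sup>\<star> \<in> ker A}\<close> of the solution set, that is, \<open>X - x\<^sup>\<star> = (C - x\<^sup>\<star>) \<inter> ker A\<close>.

  The description has two sources. Comparing a solution \<open>x\<close> with nearby points on segments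
  gives the optimality condition \<open>A\<^sup>T (b - A x) \<in> \<partial>f x\<close>, and the quadratic growth of the
  least-squares term then shows that all solutions share the residual \<open>r\<close>; so \<open>X\<close>
  consists of the points \<open>x\<close> with \<open>A x = A x\<^sup>\<star>\<close> and \<open>u \<in> \<partial>f x\<close>
  (lemma \<open>minimizers_least_squares\<close>). Secondly, \<open>u \<in> \<partial>f x\<close> is the same as
  \<open>x \<in> \<partial>f\<^sup>* u\<close> (lemmas \<open>subdifferential_conjugateI\<close> and
  \<open>subdifferential_conjugateD\<close>). The inclusion of \<open>\<partial>f\<^sup>*\<close> in the inverse of \<open>\<partial>f\<close> is the part
  that uses closedness and convexity of the epigraph, through a separating hyperplane.

  Parts (i) and (ii) translate this set by \<open>x\<^sub>r\<^sup>\<star>\<close> and by \<open>x\<^sup>\<star>\<close>; the two translations meet \<open>ker A\<close>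
  in translates of the same set because \<open>x\<^sup>\<star> - x\<^sub>r\<^sup>\<star> = x\<^sub>k\<^sup>\<star>\<close> lies in the kernel. Part (iii) is linear algebra:
  a vector projects to \<open>0\<close> on \<open>ker A\<close> iff it is orthogonal to \<open>ker A\<close> iff it lies in
  \<open>ran A\<^sup>T\<close>, and a nonzero element of \<open>(C - x\<^sup>\<star>) \<inter> ker A\<close> is its own projection.\<close>

section \<open>Conjugates and subdifferentials\<close>

lemma conjugate_upper:
  assumes "f x = ereal a" shows "ereal (w \<bullet> x - a) \<le> conjugate f w"
  unfolding conjugate_def by (rule SUP_upper2[of x]) (use assms in auto)

text \<open>The Fenchel equality: a subgradient at \<open>x\<close> says exactly that \<open>x\<close> attains the supremum
  defining the conjugate.\<close>

lemma conjugate_eq_of_subgradient: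
  assumes "f x = ereal a" "u \<in> subdifferential f x"
  shows "conjugate f u = ereal (u \<bullet> x - a)"
proof (rule antisym)
  have "ereal (u \<bullet> y) - f y \<le> ereal (u \<bullet> x - a)" for y
  proof -
    have "ereal a + ereal (u \<bullet> (y - x)) \<le> f y"
      using assms by (auto simp: subdifferential_def dest: spec[of _ y])
    then show ?thesis
      by (cases "f y") (auto simp: inner_diff_right)
  qed
  then show "conjugate f u \<le> ereal (u \<bullet> x - a)"
    unfolding conjugate_def by (intro SUP_least)
qed (use conjugate_upper assms in blast)

lemma subdifferential_conjugateI:
  assumes "f x = ereal a" "u \<in> subdifferential f x"
  shows "x \<in> subdifferential (conjugate f) u"
proof -
  have "conjugate f u + ereal (x \<bullet> (w - u)) \<le> conjugate f w" for w
    using conjugate_upper[of f x a w] assms(1)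
    by (simp add: conjugate_eq_of_subgradient[OF assms] inner_diff_right inner_commute)
  then show ?thesis by (simp add: subdifferential_def)
qed

lemma convex_epigraph:
  assumes "convex_fun f"
  shows "convex {(x, s::real). f x \<le> ereal s}"
  unfolding convex_alt
proof (intro ballI allI impI)
  fix p q :: "'a \<times> real" and t :: real
  assume p: "p \<in> {(x, s). f x \<le> ereal s}" and q: "q \<in> {(x, s). f x \<le> ereal s}"
    and t: "0 \<le> t \<and> t \<le> 1"
  obtain x s y s' where pq: "p = (x, s)" "q = (y, s')" by (meson surj_pair)
  have "f ((1 - t) *\<^sub>R x + t *\<^sub>R y) \<le> ereal (1 - t) * f x + ereal t * f y"
    using assms t by (auto simp: convex_fun_def)
  also have "\<dots> \<le> ereal (1 - t) * ereal s + ereal t * ereal s'"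
    using p q pq t by (intro add_mono ereal_mult_left_mono) auto
  finally show "(1 - t) *\<^sub>R p + t *\<^sub>R q \<in> {(x, s). f x \<le> ereal s}"
    by (simp add: pq)
qed

lemma closed_epigraph:
  fixes f :: "'a::topological_space \<Rightarrow> ereal"
  assumes "lsc_fun f"
  shows "closed {(x, s::real). f x \<le> ereal s}"
proof -
  have "open (- {(x, s::real). f x \<le> ereal s})"
  proof (rule Topological_Spaces.openI)
    fix p assume "p \<in> - {(x, s::real). f x \<le> ereal s}"
    then obtain x s where p: "p = (x, s)" "ereal s < f x"
      by (cases p) (auto simp: not_le)
    then obtain c where c: "ereal s < ereal c" "ereal c < f x"
      using ereal_dense2 by blast
    have "ereal c < Liminf (at x) f"
      using c assms by (auto simp: lsc_fun_def intro: less_le_trans)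
    then have "\<forall>\<^sub>F y in at x. ereal c < f y" by (rule less_LiminfD)
    \<comment> \<open>The limit inferior ignores the centre, where the bound holds by the choice of \<open>c\<close>.\<close>
    then have "\<forall>\<^sub>F y in nhds x. ereal c < f y"
      using c by (simp add: eventually_nhds_conv_at)
    then obtain U where U: "open U" "x \<in> U" "\<And>y. y \<in> U \<Longrightarrow> ereal c < f y"
      unfolding eventually_nhds by blast
    have "U \<times> {..<c} \<subseteq> - {(x, s::real). f x \<le> ereal s}"
    proof (rule subsetI)
      fix yv assume "yv \<in> U \<times> {..<c}"
      then obtain y v where yv: "yv = (y, v)" "y \<in> U" "v < c" by auto
      have "ereal v < f y" using U(3)[OF yv(2)] yv(3) by (metis less_ereal.simps(1) less_trans)
      then show "yv \<in> - {(x, s::real). f x \<le> ereal s}" by (simp add: yv not_le)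
    qed
    then show "\<exists>T. open T \<and> p \<in> T \<and> T \<subseteq> - {(x, s::real). f x \<le> ereal s}"
      using U c p by (intro exI[of _ "U \<times> {..<c}"]) (auto intro: open_Times)
  qed
  then show ?thesis by (simp add: closed_def)
qed

text \<open>If \<open>f z\<close> exceeded the value \<open>m = \<langle>u, z\<rangle> - f\<^sup>* u\<close> predicted by the Fenchel
  equality, a hyperplane would separate \<open>(z, m)\<close> from the epigraph of \<open>f\<close>. Its slope \<open>w\<close> would
  satisfy \<open>f\<^sup>* w < f\<^sup>* u + \<langle>z, w - u\<rangle>\<close>, contrary to the choice of \<open>z\<close>. A vertical
  hyperplane has no slope, but adding the affine minorant \<open>\<langle>u, \<cdot>\<rangle> - f\<^sup>* u\<close> tilts it.\<close>

lemma subdifferential_conjugateD: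
  fixes f :: "'a::euclidean_space \<Rightarrow> ereal"
  assumes "proper_fun f" "lsc_fun f" "convex_fun f" "conjugate f u \<noteq> \<infinity>"
    and z: "z \<in> subdifferential (conjugate f) u"
  shows "u \<in> subdifferential f z"
proof -
  obtain x0 a0 where x0: "f x0 = ereal a0"
    using assms(1) by (metis ereal_cases proper_fun_def)
  then obtain k where k: "conjugate f u = ereal k"
    using assms(4) conjugate_upper[of f x0 a0 u] by (cases "conjugate f u") auto
  define m where "m = u \<bullet> z - k"
  have minorant: "ereal (u \<bullet> y - k) \<le> f y" for y
  proof -
    have "ereal (u \<bullet> y) - f y \<le> ereal k"
      unfolding k[symmetric] conjugate_def by (rule SUP_upper) simp
    then show ?thesis by (cases "f y") auto
  qed
  have "f z \<le> ereal m"
  proof (rule ccontr)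
    assume "\<not> f z \<le> ereal m"
    then have "(z, m) \<notin> {(x, s::real). f x \<le> ereal s}" by simp
    then obtain pq c where sep: "pq \<bullet> (z, m) < c"
      "\<And>y. y \<in> {(x, s::real). f x \<le> ereal s} \<Longrightarrow> c < pq \<bullet> y"
      using separating_hyperplane_closed_point
        [OF convex_epigraph[OF assms(3)] closed_epigraph[OF assms(2)]] by metis
    obtain p q where pq: "pq = (p, q)" by (cases pq)
    have sep_z: "p \<bullet> z + q * m < c" using sep(1) pq by simp
    have sep_epi: "c < p \<bullet> y + q * s" if "f y \<le> ereal s" for y s
      using sep(2)[of "(y, s)"] that pq by simp
    \<comment> \<open>The epigraph is unbounded upwards.\<close>
    have "0 \<le> q"
    proof (rule ccontr)
      assume "\<not> 0 \<le> q"
      define s where "s = max a0 ((c - p \<bullet> x0) / q)"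
      have "c < p \<bullet> x0 + q * s" by (rule sep_epi) (simp add: x0 s_def)
      moreover have "q * s \<le> c - p \<bullet> x0"
        using \<open>\<not> 0 \<le> q\<close> mult_left_mono_neg[of "(c - p \<bullet> x0) / q" s q] by (simp add: s_def)
      ultimately show False by simp
    qed
    define w where "w = (1 / (q + 1)) *\<^sub>R (u - p)"
    define h where "h = (k - c) / (q + 1)"
    have w: "(q + 1) * (w \<bullet> y) = (u - p) \<bullet> y" for y
      using \<open>0 \<le> q\<close> by (simp add: w_def)
    have h: "(q + 1) * h = k - c"
      using \<open>0 \<le> q\<close> by (simp add: h_def)
    have "conjugate f w \<le> ereal h"
      unfolding conjugate_def
    proof (rule SUP_least)
      fix y
      show "ereal (w \<bullet> y) - f y \<le> ereal h"
      proof (cases "f y")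
        case (real s)
        then have "c < p \<bullet> y + q * s" "u \<bullet> y - k \<le> s"
          using sep_epi[of y s] minorant[of y] by auto
        then have "(u - p) \<bullet> y - (q + 1) * s \<le> k - c"
          by (simp add: algebra_simps)
        then have "(q + 1) * (w \<bullet> y - s) \<le> (q + 1) * h"
          by (simp only: right_diff_distrib w h)
        then have "w \<bullet> y - s \<le> h"
          using \<open>0 \<le> q\<close> by simp
        then show ?thesis by (simp add: real)
      qed (use minorant[of y] in auto)
    qed
    moreover have "ereal k + ereal (z \<bullet> (w - u)) \<le> conjugate f w"
      using z k by (auto simp: subdifferential_def)
    ultimately have "ereal (k + z \<bullet> (w - u)) \<le> ereal h" by (metis order_trans plus_ereal.simps(1))
    then have "z \<bullet> w - m \<le> h"
      by (simp add: m_def inner_diff_right inner_commute)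
    then have "(q + 1) * (w \<bullet> z - m) \<le> (q + 1) * h"
      using \<open>0 \<le> q\<close> by (simp add: inner_commute)
    then have "(u - p) \<bullet> z - (q + 1) * m \<le> k - c"
      by (simp only: right_diff_distrib w h)
    then show False
      using sep_z by (simp add: m_def algebra_simps inner_commute)
  qed
  moreover have "ereal m + ereal (u \<bullet> (y - z)) \<le> f y" for y
    using minorant[of y] by (simp add: m_def inner_diff_right)
  ultimately show ?thesis
    unfolding subdifferential_def by (auto intro: order_trans[OF add_right_mono])
qed

section \<open>The solution set\<close>

lemma half_norm_sq_diff:
  fixes e r :: "'a::real_inner"
  shows "1/2 * (norm (e - r))\<^sup>2 = 1/2 * (norm e)\<^sup>2 - r \<bullet> e + 1/2 * (norm r)\<^sup>2"
  by (simp add: power2_norm_eq_inner algebra_simps inner_commute)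

lemma minimizer_finite:
  assumes "proper_fun f" "x \<in> minimizers (\<lambda>x. f x + ereal (g x))"
  obtains a where "f x = ereal a"
proof -
  obtain x0 where "f x0 \<noteq> \<infinity>" using assms(1) by (auto simp: proper_fun_def)
  moreover have "f x + ereal (g x) \<le> f x0 + ereal (g x0)"
    using assms(2) by (auto simp: minimizers_def)
  moreover have "f x0 \<noteq> -\<infinity>" "f x \<noteq> -\<infinity>" using assms(1) by (auto simp: proper_fun_def)
  ultimately show ?thesis using that by (cases "f x"; cases "f x0") auto
qed

text \<open>Moving from the solution \<open>x\<close> towards \<open>y\<close> by a step \<open>t\<close> changes the objective by at most
  \<open>t (f y - f x - \<langle>r, A (y - x)\<rangle>) + O(t\<^sup>2)\<close>, where \<open>r = b - A x\<close>. As this is nonnegative, so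
  is the coefficient of \<open>t\<close>.\<close>

lemma least_squares_optimality:
  fixes A :: "real^'n^'m"
  assumes "proper_fun f" "convex_fun f"
    and min: "x \<in> minimizers (\<lambda>x. f x + ereal (1/2 * (norm (A *v x - b))\<^sup>2))"
  shows "transpose A *v (b - A *v x) \<in> subdifferential f x"
proof -
  define r where "r = b - A *v x"
  obtain a where a: "f x = ereal a" using minimizer_finite[OF assms(1) min] .
  have "ereal a + ereal ((transpose A *v r) \<bullet> (y - x)) \<le> f y" for y
  proof (cases "f y")
    case (real c)
    define d where "d = A *v (y - x)"
    have bound: "a - c + r \<bullet> d \<le> t * (1/2 * (norm d)\<^sup>2)" if t: "0 < t" "t < 1" for t
    proof -
      define w where "w = (1 - t) *\<^sub>R x + t *\<^sub>R y"
      have "w = x + t *\<^sub>R (y - x)" by (simp add: w_def algebra_simps)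
      then have Aw: "A *v w - b = t *\<^sub>R d - r"
        by (simp add: d_def r_def matrix_vector_right_distrib matrix_vector_mult_scaleR)
      have Ax: "A *v x - b = 0 - r" by (simp add: r_def)
      have "f x + ereal (1/2 * (norm (A *v x - b))\<^sup>2)
          \<le> f w + ereal (1/2 * (norm (A *v w - b))\<^sup>2)"
        using min by (simp add: minimizers_def)
      also have "f w \<le> ereal (1 - t) * f x + ereal t * f y"
        using assms(2) t by (auto simp: convex_fun_def w_def)
      finally have "a + 1/2 * (norm (0 - r))\<^sup>2
          \<le> (1 - t) * a + t * c + 1/2 * (norm (t *\<^sub>R d - r))\<^sup>2"
        unfolding Aw Ax a real by (simp add: add_right_mono)
      then have "t * (a - c + r \<bullet> d) \<le> t * (t * (1/2 * (norm d)\<^sup>2))"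
        unfolding half_norm_sq_diff by (simp add: power_mult_distrib power2_eq_square algebra_simps)
      then show ?thesis using t by simp
    qed
    have "((\<lambda>t. t * (1/2 * (norm d)\<^sup>2)) \<longlongrightarrow> 0 * (1/2 * (norm d)\<^sup>2)) (at_right 0)"
      by (intro tendsto_intros)
    moreover have "\<forall>\<^sub>F t in at_right 0. a - c + r \<bullet> d \<le> t * (1/2 * (norm d)\<^sup>2)"
      unfolding eventually_at_right_field using bound by (intro exI[of _ 1]) auto
    ultimately have "a - c + r \<bullet> d \<le> 0"
      using tendsto_lowerbound[OF _ _ trivial_limit_at_right_real] by fastforce
    then show ?thesis
      by (simp add: real d_def dot_lmul_matrix flip: matrix_vector_mul_assoc)
  qed (use assms(1) in \<open>auto simp: proper_fun_def\<close>)
  then show ?thesis by (simp add: subdifferential_def a r_def)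
qed

text \<open>The subgradient \<open>A\<^sup>T (b - A x)\<close> at \<open>x\<close> makes the objective grow at least like
  \<open>\<parallel>A (y - x)\<parallel>\<^sup>2 / 2\<close> away from \<open>x\<close>, the linear terms of \<open>f\<close> and of the square cancelling.\<close>

lemma least_squares_growth:
  fixes A :: "real^'n^'m"
  assumes a: "f x = ereal a" and "transpose A *v (b - A *v x) \<in> subdifferential f x"
  shows "f x + ereal (1/2 * (norm (A *v x - b))\<^sup>2) + ereal (1/2 * (norm (A *v (y - x)))\<^sup>2)
    \<le> f y + ereal (1/2 * (norm (A *v y - b))\<^sup>2)"
proof -
  define r where "r = b - A *v x"
  define d where "d = A *v (y - x)"
  have Ay: "A *v y - b = d - r" and Ax: "A *v x - b = 0 - r"
    by (simp_all add: d_def r_def matrix_vector_mult_diff_distrib)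
  have "f x + ereal (r \<bullet> d) \<le> f y"
    using assms(2) by (simp add: subdifferential_def r_def d_def dot_lmul_matrix)
  then show ?thesis
    unfolding Ay Ax half_norm_sq_diff d_def[symmetric]
    by (cases "f y") (auto simp: a)
qed

lemma minimizers_least_squares:
  fixes A :: "real^'n^'m"
  assumes "proper_fun f" "convex_fun f"
    and X: "X = minimizers (\<lambda>x. f x + ereal (1/2 * (norm (A *v x - b))\<^sup>2))"
    and xs: "xs \<in> X"
  shows "X = {x. A *v x = A *v xs \<and> transpose A *v (b - A *v xs) \<in> subdifferential f x}"
proof (intro set_eqI iffI)
  fix x assume x: "x \<in> X"
  obtain a where a: "f x = ereal a" using minimizer_finite[OF assms(1) x[unfolded X]] .
  obtain a' where a': "f xs = ereal a'" using minimizer_finite[OF assms(1) xs[unfolded X]] .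
  have opt: "transpose A *v (b - A *v x) \<in> subdifferential f x"
    using least_squares_optimality assms(1,2) x X by blast
  have "f xs + ereal (1/2 * (norm (A *v xs - b))\<^sup>2) \<le> f x + ereal (1/2 * (norm (A *v x - b))\<^sup>2)"
    using xs X by (simp add: minimizers_def)
  with least_squares_growth[OF a opt, of xs] have "(norm (A *v (xs - x)))\<^sup>2 \<le> 0"
    unfolding a a' plus_ereal.simps ereal_less_eq by linarith
  then have "A *v x = A *v xs" by (simp add: matrix_vector_mult_diff_distrib)
  with opt show "x \<in> {x. A *v x = A *v xs \<and> transpose A *v (b - A *v xs) \<in> subdifferential f x}"
    by simp
next
  fix x assume "x \<in> {x. A *v x = A *v xs \<and> transpose A *v (b - A *v xs) \<in> subdifferential f x}"
  then have Ax: "A *v x = A *v xs" and sub: "transpose A *v (b - A *v x) \<in> subdifferential f x"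
    by auto
  obtain a' where a': "f xs = ereal a'" using minimizer_finite[OF assms(1) xs[unfolded X]] .
  have "f x + ereal ((transpose A *v (b - A *v x)) \<bullet> (xs - x)) \<le> f xs"
    using sub by (simp add: subdifferential_def)
  then obtain a where a: "f x = ereal a"
    using assms(1) a' by (cases "f x") (auto simp: proper_fun_def)
  have "f x + ereal (1/2 * (norm (A *v x - b))\<^sup>2) \<le> f y + ereal (1/2 * (norm (A *v y - b))\<^sup>2)" for y
    by (rule order_trans[OF _ least_squares_growth[OF a sub]]) (simp add: a)
  then show "x \<in> X" by (simp add: X minimizers_def)
qed

text \<open>The subgradient \<open>A\<^sup>T r\<close>, with \<open>r = b - A xs\<close>, at the known solution makes \<open>f\<^sup>* (A\<^sup>T r)\<close> finite. So
  \<open>\<partial>f\<^sup>*\<close> can be inverted there, which turns the condition on subgradients of \<open>f\<close> at each solution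
  into membership in one fixed set.\<close>

lemma minimizers_via_conjugate:
  fixes A :: "real^'n^'m"
  assumes "proper_fun f" "lsc_fun f" "convex_fun f"
    and X: "X = minimizers (\<lambda>x. f x + ereal (1/2 * (norm (A *v x - b))\<^sup>2))"
    and xs: "xs \<in> X"
  shows "X = {x \<in> subdifferential (conjugate f) (transpose A *v (b - A *v xs)). x - xs \<in> mat_ker A}"
proof -
  define u where "u = transpose A *v (b - A *v xs)"
  have X': "X = {x. A *v x = A *v xs \<and> u \<in> subdifferential f x}"
    unfolding u_def using minimizers_least_squares[OF assms(1,3) X xs] .
  have finite_value: "\<exists>a. f x = ereal a" if "x \<in> X" for x
    using minimizer_finite[OF assms(1) that[unfolded X]] by blast
  then obtain a where "f xs = ereal a" using xs by blast
  then have "conjugate f u \<noteq> \<infinity>"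
    using conjugate_eq_of_subgradient[of f xs a u] X' xs by simp
  then have "u \<in> subdifferential f x" if "x \<in> subdifferential (conjugate f) u" for x
    using subdifferential_conjugateD assms(1-3) that by blast
  moreover have "x \<in> subdifferential (conjugate f) u" if "x \<in> X" for x
    using finite_value[OF that] subdifferential_conjugateI[of f x _ u] that X' by blast
  ultimately show ?thesis
    unfolding u_def[symmetric] using X'
    by (auto simp: mat_ker_def matrix_vector_mult_diff_distrib)
qed

section \<open>Projections onto the kernel\<close>

lemma orth_proj_diff:
  fixes S :: "'a::euclidean_space set"
  assumes "subspace S"
  shows "orth_proj S (x - y) = orth_proj S x - orth_proj S y"
proof (rule orth_proj_eqI[OF assms])
  show "orth_proj S x - orth_proj S y \<in> S"
    using orth_proj_props(1)[OF assms] assms by (simp add: subspace_diff)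
next
  fix z assume "z \<in> S"
  then have "(x - orth_proj S x) \<bullet> z = 0" "(y - orth_proj S y) \<bullet> z = 0"
    using orth_proj_props(2)[OF assms] by (auto simp: orthogonal_def)
  then show "orthogonal (x - y - (orth_proj S x - orth_proj S y)) z"
    by (simp add: orthogonal_def inner_diff_left)
qed

lemma orth_proj_eq_0_iff:
  fixes S :: "'a::euclidean_space set"
  assumes "subspace S"
  shows "orth_proj S x = 0 \<longleftrightarrow> (\<forall>z\<in>S. orthogonal x z)"
proof
  assume "orth_proj S x = 0"
  then show "\<forall>z\<in>S. orthogonal x z"
    using orth_proj_props(2)[OF assms, of _ x] by simp
next
  assume "\<forall>z\<in>S. orthogonal x z"
  then show "orth_proj S x = 0"
    by (intro orth_proj_eqI assms subspace_0) simp
qed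

lemma orth_proj_ident:
  assumes "subspace S" "x \<in> S"
  shows "orth_proj S x = x"
  using assms by (intro orth_proj_eqI) (auto simp: orthogonal_def)

lemma orthogonal_ran_transpose_ker:
  assumes "v \<in> mat_ran (transpose A)" "z \<in> mat_ker A"
  shows "orthogonal v z"
  using assms by (auto simp: mat_ran_def mat_ker_def orthogonal_def dot_lmul_matrix)

text \<open>The orthogonal decomposition along \<open>ran A\<^sup>T\<close> and \<open>ker A\<close>: the residual
  \<open>x - P x\<close> of the projection onto \<open>ran A\<^sup>T\<close> satisfies \<open>\<langle>z, A (x - P x)\<rangle> = 0\<close> for every \<open>z\<close>,
  so it lies in \<open>ker A\<close>.\<close>

lemma orth_proj_ker:
  fixes A :: "real^'n^'m"
  shows "orth_proj (mat_ker A) x = x - orth_proj (mat_ran (transpose A)) x"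
proof (rule orth_proj_eqI[OF subspace_mat_ker])
  let ?p = "orth_proj (mat_ran (transpose A)) x"
  have "(A *v (x - ?p)) \<bullet> z = 0" for z
  proof -
    have "transpose A *v z \<in> mat_ran (transpose A)" by (simp add: mat_ran_def)
    then have "(transpose A *v z) \<bullet> (x - ?p) = 0"
      using orth_proj_props(2)[OF subspace_mat_ran, of _ "transpose A" x]
      by (simp add: orthogonal_def inner_commute)
    then show ?thesis by (simp add: dot_lmul_matrix inner_commute)
  qed
  from this[of "A *v (x - ?p)"] show "x - ?p \<in> mat_ker A"
    by (simp only: mat_ker_def mem_Collect_eq inner_eq_zero_iff)
  show "orthogonal (x - (x - ?p)) z" if "z \<in> mat_ker A" for z
    using orthogonal_ran_transpose_ker[OF orth_proj_props(1)[OF subspace_mat_ran] that] by simp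
qed

lemma orth_proj_ker_eq_0_iff:
  fixes A :: "real^'n^'m"
  shows "orth_proj (mat_ker A) x = 0 \<longleftrightarrow> x \<in> mat_ran (transpose A)"
proof
  assume "orth_proj (mat_ker A) x = 0"
  then show "x \<in> mat_ran (transpose A)"
    using orth_proj_ker[of A x] orth_proj_props(1)[OF subspace_mat_ran, of "transpose A" x] by simp
next
  assume "x \<in> mat_ran (transpose A)"
  then show "orth_proj (mat_ker A) x = 0"
    using orthogonal_ran_transpose_ker by (auto simp: orth_proj_eq_0_iff[OF subspace_mat_ker])
qed

section \<open>Uniqueness of the solution\<close>

theorem proposition2p18:
  fixes f :: "real^'n \<Rightarrow> ereal"
    and A :: "real^'n^'m"
    and b r :: "real^'m"
    and X :: "(real^'n) set"
    and xs xr xk :: "real^'n"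
  assumes "proper_fun f" and "lsc_fun f" and "convex_fun f"
    and "X = minimizers (\<lambda>x. f x + ereal (1/2 * (norm (A *v x - b))\<^sup>2))"
    and "xs \<in> X"
    and "r = b - A *v xs"
    and "xr = orth_proj (mat_ran (transpose A)) xs"
    and "xk = orth_proj (mat_ker A) xs"
  shows
    "(X = {xs} \<longleftrightarrow>
        is_singleton
          (translate_minus (subdifferential (conjugate f) (transpose A *v r)) xr \<inter> mat_ker A)) \<and>
     (X = {xs} \<longleftrightarrow>
        translate_minus (subdifferential (conjugate f) (transpose A *v r)) xs \<inter> mat_ker A = {0}) \<and>
     (orth_proj (mat_ker A) `
          translate_minus (subdifferential (conjugate f) (transpose A *v r)) xs = {0}
        \<longrightarrow> X = {xs}) \<and>
     (orth_proj (mat_ker A) `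
          translate_minus (subdifferential (conjugate f) (transpose A *v r)) xs = {0}
        \<longleftrightarrow>
      orth_proj (mat_ker A) ` subdifferential (conjugate f) (transpose A *v r) = {xk}) \<and>
     (orth_proj (mat_ker A) `
          translate_minus (subdifferential (conjugate f) (transpose A *v r)) xs = {0}
        \<longleftrightarrow>
      perp (translate_minus (subdifferential (conjugate f) (transpose A *v r)) xs) (mat_ker A)) \<and>
     (perp (translate_minus (subdifferential (conjugate f) (transpose A *v r)) xs) (mat_ker A)
        \<longleftrightarrow>
      subdifferential (conjugate f) (transpose A *v r)
        \<subseteq> (\<lambda>v. xk + v) ` mat_ran (transpose A))"
proof -
  define C where "C = subdifferential (conjugate f) (transpose A *v r)"
  define P where "P = orth_proj (mat_ker A)"
  have X: "X = {x \<in> C. x - xs \<in> mat_ker A}"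
    unfolding C_def assms(6) using minimizers_via_conjugate[OF assms(1-5)] .
  have xsC: "xs \<in> C" using assms(5) X by blast
  have xs_decomp: "xs = xr + xk" by (simp add: assms(7,8) orth_proj_ker)
  have xk_ker: "xk \<in> mat_ker A" using orth_proj_props(1)[OF subspace_mat_ker] assms(8) by blast
  have xr_ran: "xr \<in> mat_ran (transpose A)"
    using orth_proj_props(1)[OF subspace_mat_ran] assms(7) by blast
  have P_diff: "P (c - xs) = P c - xk" for c
    by (simp add: P_def assms(8) orth_proj_diff[OF subspace_mat_ker])
  have ker_shift: "c - xr \<in> mat_ker A \<longleftrightarrow> c - xs \<in> mat_ker A" for c
    using subspace_add[OF subspace_mat_ker _ xk_ker, of "c - xs"]
      subspace_diff[OF subspace_mat_ker _ xk_ker, of "c - xr"]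
    by (auto simp: xs_decomp algebra_simps)
  have ran_shift: "c - xk \<in> mat_ran (transpose A) \<longleftrightarrow> c - xs \<in> mat_ran (transpose A)" for c
    using subspace_add[OF subspace_mat_ran _ xr_ran, of "c - xs"]
      subspace_diff[OF subspace_mat_ran _ xr_ran, of "c - xk"]
    by (auto simp: xs_decomp algebra_simps)

  have inter_r: "translate_minus C xr \<inter> mat_ker A = (\<lambda>x. x - xr) ` X"
    by (auto simp: X translate_minus_def ker_shift)
  have inter_s: "translate_minus C xs \<inter> mat_ker A = (\<lambda>x. x - xs) ` X"
    by (auto simp: X translate_minus_def)
  have i: "X = {xs} \<longleftrightarrow> is_singleton (translate_minus C xr \<inter> mat_ker A)"
  proof
    assume "is_singleton (translate_minus C xr \<inter> mat_ker A)"
    then obtain a where a: "(\<lambda>x. x - xr) ` X = {a}"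
      unfolding inter_r by (rule is_singletonE)
    have "x = xs" if "x \<in> X" for x
    proof -
      have "x - xr \<in> {a}" "xs - xr \<in> {a}"
        unfolding a[symmetric] using that assms(5) by (auto intro: imageI)
      then have "x - xr = xs - xr" by simp
      then show ?thesis by simp
    qed
    then show "X = {xs}" using assms(5) by blast
  qed (simp add: inter_r)
  have ii: "X = {xs} \<longleftrightarrow> translate_minus C xs \<inter> mat_ker A = {0}"
  proof
    assume "translate_minus C xs \<inter> mat_ker A = {0}"
    then have "x - xs \<in> {0}" if "x \<in> X" for x
      unfolding inter_s using that by blast
    then have "x = xs" if "x \<in> X" for x using that by force
    then show "X = {xs}" using assms(5) by blast
  qed (simp add: inter_s)

  \<comment> \<open>As \<open>C\<close> contains \<open>xs\<close>, the set conditions in (iii) amount to a condition on each point of \<open>C\<close>.\<close>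
  have proj: "P ` translate_minus C xs = {0} \<longleftrightarrow> (\<forall>c\<in>C. P (c - xs) = 0)"
    using xsC by (auto simp: translate_minus_def image_image)
  have proj': "P ` C = {xk} \<longleftrightarrow> (\<forall>c\<in>C. P (c - xs) = 0)"
    using xsC by (auto simp: P_diff)
  have perp: "perp (translate_minus C xs) (mat_ker A) \<longleftrightarrow> (\<forall>c\<in>C. P (c - xs) = 0)"
    by (auto simp: perp_def translate_minus_def P_def orth_proj_eq_0_iff[OF subspace_mat_ker])
  have "c \<in> (\<lambda>v. xk + v) ` mat_ran (transpose A) \<longleftrightarrow> P (c - xs) = 0" for c
  proof -
    have "c \<in> (\<lambda>v. xk + v) ` mat_ran (transpose A) \<longleftrightarrow> c - xk \<in> mat_ran (transpose A)"
      by (force simp: image_iff algebra_simps)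
    then show ?thesis by (simp add: ran_shift P_def orth_proj_ker_eq_0_iff)
  qed
  then have incl: "C \<subseteq> (\<lambda>v. xk + v) ` mat_ran (transpose A) \<longleftrightarrow> (\<forall>c\<in>C. P (c - xs) = 0)"
    by blast
  have unique: "X = {xs}" if "\<forall>c\<in>C. P (c - xs) = 0"
  proof -
    have "x = xs" if x: "x \<in> C" "x - xs \<in> mat_ker A" for x
    proof -
      have "P (x - xs) = x - xs"
        unfolding P_def using orth_proj_ident[OF subspace_mat_ker x(2)] .
      moreover have "P (x - xs) = 0" using x(1) \<open>\<forall>c\<in>C. P (c - xs) = 0\<close> by blast
      ultimately show ?thesis by simp
    qed
    then show ?thesis using assms(5) unfolding X by blast
  qed
  show ?thesis
    unfolding C_def[symmetric] P_def[symmetric]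
    using i ii proj proj' perp incl unique by blast
qed

end
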